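(* Let $K$ be a convex set in the plane $\mathbb{R}^2$ with area $1$. Let $K_n$ be a set of $n$ points chosen independently and uniformly at random from $K$. Let $\mathrm{Max}(K_n)$ denote the random variable that measures the largest area of a convex $K_n$-hole. Then w.h.p. $$(1+o(1))\frac{\log n}{n} \le \mathrm{Max}(K_n) \le (4+o(1))\frac{\log n}{n}.$$
   Context: A $K_n$-hole (or simply a hole) is a subset of $K$ whose interior does not contain any point of $K_n$; a convex hole is a hole that is a convex set. "Largest" area means the supremum of the areas of such holes. $\log$ is the natural logarithm. "W.h.p." (with high probability) means with probability tending to $1$ as $n\to\infty$, with $K$ fixed; the conclusion means: for every $\epsilon>0$, the probability that $(1-\epsilon)\frac{\log n}{n}\le \mathrm{Max}(K_n)\le (4+\epsilon)\frac{\log n}{n}$ tends to $1$ as $n\to\infty$. *)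

theory Defs
  imports "HOL-Probability.Probability"
begin

text \<open>The interior is taken in the plane (not relative to \<open>K\<close>), so sets with empty interior
  are holes.\<close>

definition hole :: "(real^2) set \<Rightarrow> (real^2) set \<Rightarrow> (real^2) set \<Rightarrow> bool" where
  "hole K P H \<longleftrightarrow> H \<subseteq> K \<and> interior H \<inter> P = {}"

text \<open>Convex sets in the plane are Lebesgue measurable but need not be Borel, so area is
  \<^const>\<open>lebesgue\<close> measure. The set of areas below contains \<open>0\<close> (the empty hole), and
  is bounded above by the area of \<open>K\<close> whenever \<open>K\<close> has finite area, so the real supremum is
  then a genuine one.\<close>

definition max_hole :: "(real^2) set \<Rightarrow> (real^2) set \<Rightarrow> real" where
  "max_hole K P = (SUP H\<in>{H. convex H \<and> hole K P H}. measure lebesgue H)"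

text \<open>The joint law of \<open>n\<close> independent uniform points of \<open>K\<close>; a sample \<open>\<omega>\<close> yields the point set
  \<open>\<omega> ` {..<n}\<close>, which has exactly \<open>n\<close> elements almost surely.\<close>

definition uniform_points :: "(real^2) set \<Rightarrow> nat \<Rightarrow> (nat \<Rightarrow> real^2) measure" where
  "uniform_points K n = PiM {..<n} (\<lambda>_. uniform_measure lebesgue K)"

end

theory Submission imports Defs "HOL-Real_Asymp.Real_Asymp"
begin

text \<open>Lower bound: cut \<open>K\<close> by parallel lines into about \<open>1 / a\<close> slabs of area
  \<open>a = (1 - \<epsilon>) ln n / n\<close>. The expected number of empty slabs is about
  \<open>n powr \<epsilon> / ln n\<close>, and distinct slabs are negatively correlated, so by the second moment method
  some slab is empty.

  Upper bound: let \<open>H\<close> be a convex hole of area more than \<open>A = 4 ln n / n\<close>. For a fixed positive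
  proportion of all triples \<open>(p, q, r)\<close> in \<open>H\<close>, the set \<open>H\<close> has bounded coordinates in the affine
  frame \<open>(p, q, r)\<close> and contains the standard simplex of that frame, so \<open>H\<close> contains the affine
  image of one of finitely many fixed shapes that covers at least \<open>81/100\<close> of its area. Hence the
  triples in \<open>K\<close> for which some such image is large but contains no sample point have measure of
  order \<open>A ^ 3\<close> at least. The expected measure of these triples is of order
  \<open>(1 - 81/100 * A) ^ n\<close>, which is about \<open>n powr (-3.24)\<close>, so Markov's inequality applies.\<close>

section \<open>Convex sets and measurability of the largest hole area\<close>

lemma negligible_convex_diff_interior:
  fixes S :: "'a::euclidean_space set"
  assumes "convex S"
  shows "negligible (S - interior S)"
  by (rule negligible_subset[OF negligible_convex_frontier[OF assms]])
     (use closure_subset in \<open>auto simp: frontier_def\<close>)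

text \<open>A convex set is its interior together with part of its frontier, which is null, so
  completeness of Lebesgue measure gives measurability.\<close>

lemma convex_sets_lebesgue:
  fixes S :: "'a::euclidean_space set"
  assumes "convex S"
  shows "S \<in> sets lebesgue"
proof -
  have "negligible (S - interior S)"
    by (rule negligible_convex_diff_interior[OF assms])
  then have "S - interior S \<in> sets lebesgue"
    by (simp add: negligible_iff_null_sets null_setsD2)
  then have "interior S \<union> (S - interior S) \<in> sets lebesgue"
    by (intro sets.Un) auto
  then show ?thesis
    using interior_subset[of S] by (simp add: Un_absorb1)
qed

lemma measure_interior_convex:
  fixes S :: "'a::euclidean_space set"
  assumes "convex S"
  shows "measure lebesgue (interior S) = measure lebesgue S"
proof -
  have "negligible (S - interior S)"
    by (rule negligible_convex_diff_interior[OF assms])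
  then have "AE x in lebesgue. x \<in> interior S \<longleftrightarrow> x \<in> S"
    using interior_subset[of S]
    by (intro AE_I'[of "S - interior S"]) (auto simp: negligible_iff_null_sets)
  then show ?thesis
    by (intro measure_eq_AE) (auto simp: convex_sets_lebesgue assms)
qed

lemma lmeasurable_subset_convex:
  fixes K H :: "'a::euclidean_space set"
  assumes "K \<in> lmeasurable" "convex H" "H \<subseteq> K"
  shows "H \<in> lmeasurable"
  using fmeasurableI2[OF assms(1,3)] convex_sets_lebesgue[OF assms(2)] by auto

text \<open>The interior of \<open>H\<close> is an increasing union of finite unions of basic open
  sets, so continuity from below gives one of area above \<open>t\<close>. Its convex hull stays
  inside \<open>H\<close> and has no smaller area. A countable basis leaves only countably many such
  hulls.\<close>

lemma convex_inner_basis_approx: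
  fixes H :: "'a::euclidean_space set"
  assumes B: "topological_basis B" "countable B"
    and H: "convex H" "H \<in> lmeasurable" "t < measure lebesgue H"
  obtains F where "finite F" "F \<subseteq> B" "convex hull (\<Union>F) \<subseteq> H" "t < measure lebesgue (convex hull (\<Union>F))"
proof -
  obtain C where C: "C \<subseteq> B" "\<Union>C = interior H"
    using B(1) open_interior unfolding topological_basis_def by blast
  show ?thesis
  proof (cases "C = {}")
    \<comment> \<open>Here the interior of \<open>H\<close> is empty, so \<open>t < 0\<close> and
      the empty family suffices.\<close>
    case True
    then show ?thesis
      using C H measure_interior_convex[of H] that[of "{}"] by auto
  next
    case False
    have cC: "countable C"
      using B(2) C(1) countable_subset by blast
    define f where "f = from_nat_into C"
    have rf: "range f = C"
      using False cC by (simp add: f_def range_from_nat_into)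
    have op: "open U" if "U \<in> C" for U
      using that C B(1) topological_basis_open by blast
    define A where "A n = \<Union>(f ` {..n})" for n :: nat
    have UA: "(\<Union>n. A n) = interior H"
      using C(2) rf by (auto simp: A_def)
    have "(\<lambda>n. measure lebesgue (A n)) \<longlonglongrightarrow> measure lebesgue (\<Union>n. A n)"
    proof (rule Lim_measure_incseq)
      show "range A \<subseteq> sets lebesgue"
        using op rf by (auto simp: A_def intro!: borel_open open_UN)
      show "incseq A"
        by (force simp: A_def incseq_def)
      show "emeasure lebesgue (\<Union>n. A n) \<noteq> \<infinity>"
        using UA lmeasurable_subset_convex[OF H(2) convex_interior[OF H(1)] interior_subset]
          fmeasurableD2 by fastforce
    qed
    then have "eventually (\<lambda>n. t < measure lebesgue (A n)) sequentially"
      using H(3) measure_interior_convex[OF H(1)] UA order_tendstoD(1) by metis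
    then obtain n where n: "t < measure lebesgue (A n)"
      by (auto simp: eventually_sequentially)
    have sub: "convex hull A n \<subseteq> H"
    proof (rule hull_minimal)
      show "A n \<subseteq> H"
        using UA interior_subset by blast
    qed (fact H(1))
    have lm: "convex hull A n \<in> lmeasurable"
      using lmeasurable_subset_convex[OF H(2) _ sub] by simp
    have "measure lebesgue (A n) \<le> measure lebesgue (convex hull A n)"
    proof (rule measure_mono_fmeasurable[OF hull_subset _ lm])
      show "A n \<in> sets lebesgue"
        using op rf by (auto simp: A_def intro!: borel_open open_UN)
    qed
    then show ?thesis
      using that[of "f ` {..n}"] sub n rf C(1) by (fastforce simp: A_def)
  qed
qed

section \<open>Holes of a body of finite area\<close>

context
  fixes K :: "(real^2) set"
  assumes K: "K \<in> lmeasurable"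
begin

lemma bdd_above_hole_areas:
  "bdd_above (measure lebesgue ` {H. convex H \<and> hole K P H})"
  by (rule bdd_aboveI[of _ "measure lebesgue K"])
     (auto simp: hole_def intro!: measure_mono_fmeasurable K convex_sets_lebesgue)

lemma less_max_hole_iff:
  "t < max_hole K P \<longleftrightarrow> (\<exists>H. convex H \<and> hole K P H \<and> t < measure lebesgue H)"
proof -
  have "{} \<in> {H. convex H \<and> hole K P H}"
    by (simp add: hole_def)
  then show ?thesis
    unfolding max_hole_def by (subst less_cSUP_iff[OF _ bdd_above_hole_areas]) auto
qed

lemma measure_le_max_hole:
  "convex H \<Longrightarrow> hole K P H \<Longrightarrow> measure lebesgue H \<le> max_hole K P"
  unfolding max_hole_def by (rule cSUP_upper[OF _ bdd_above_hole_areas]) auto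

lemma max_hole_nonneg: "0 \<le> max_hole K P"
  using measure_le_max_hole[of "{}" P] by (simp add: hole_def)

text \<open>Up to arbitrarily small loss of area, it suffices to consider the countably many convex
  hulls of finite unions of basic open sets.\<close>

lemma measurable_max_hole:
  "(\<lambda>\<omega>. max_hole K (\<omega> ` {..<n})) \<in> borel_measurable (uniform_points K n)"
proof -
  let ?M = "uniform_points K n"
  obtain B :: "(real^2) set set" where B: "countable B" "topological_basis B"
    using ex_countable_basis by blast
  define \<F> where "\<F> = (\<lambda>F. convex hull (\<Union>F)) ` {F. finite F \<and> F \<subseteq> B}"
  have cF: "countable \<F>"
    unfolding \<F>_def by (intro countable_image countable_Collect_finite_subset B)
  \<comment> \<open>The approximating hull lies in a hole, so its interior also avoids
    \<open>P\<close>; this turns an uncountable existential into a countable one.\<close>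
  have eq: "t < max_hole K P \<longleftrightarrow>
      (\<exists>H\<in>{H\<in>\<F>. H \<subseteq> K \<and> t < measure lebesgue H}. interior H \<inter> P = {})" for t P
  proof
    assume "t < max_hole K P"
    then obtain H where H: "convex H" "H \<subseteq> K" "interior H \<inter> P = {}" "t < measure lebesgue H"
      by (auto simp: less_max_hole_iff hole_def)
    obtain F where F: "finite F" "F \<subseteq> B" "convex hull (\<Union>F) \<subseteq> H"
      "t < measure lebesgue (convex hull (\<Union>F))"
      using convex_inner_basis_approx[OF B(2,1) H(1) lmeasurable_subset_convex[OF K H(1,2)] H(4)] .
    have "convex hull (\<Union>F) \<in> \<F>"
      using F by (auto simp: \<F>_def)
    then show "\<exists>H\<in>{H\<in>\<F>. H \<subseteq> K \<and> t < measure lebesgue H}. interior H \<inter> P = {}"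
      using F H interior_mono[OF F(3)] by blast
  qed (auto simp: less_max_hole_iff hole_def \<F>_def)
  have "{\<omega> \<in> space ?M. t < max_hole K (\<omega> ` {..<n})} \<in> sets ?M" for t
  proof -
    have *: "{\<omega> \<in> space ?M. interior H \<inter> \<omega> ` {..<n} = {}} \<in> sets ?M" for H
    proof -
      have "{\<omega> \<in> space ?M. \<forall>i\<in>{..<n}. \<omega> i \<notin> interior H} \<in> sets ?M"
        unfolding uniform_points_def
      proof (rule sets.sets_Collect_finite_All)
        fix i assume i: "i \<in> {..<n}"
        have "{\<omega> \<in> space (Pi\<^sub>M {..<n} (\<lambda>_. uniform_measure lebesgue K)). \<omega> i \<notin> interior H} =
          (\<lambda>\<omega>. \<omega> i) -` (- interior H) \<inter> space (Pi\<^sub>M {..<n} (\<lambda>_. uniform_measure lebesgue K))"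
          by auto
        also have "\<dots> \<in> sets (Pi\<^sub>M {..<n} (\<lambda>_. uniform_measure lebesgue K))"
          by (rule measurable_sets[OF measurable_component_singleton[OF i]])
             (auto intro!: borel_closed)
        finally show "{\<omega> \<in> space (Pi\<^sub>M {..<n} (\<lambda>_. uniform_measure lebesgue K)). \<omega> i \<notin> interior H} \<in>
          sets (Pi\<^sub>M {..<n} (\<lambda>_. uniform_measure lebesgue K))" .
      qed auto
      then show ?thesis
        by (rule back_subst[of "\<lambda>X. X \<in> sets ?M"]) auto
    qed
    show ?thesis
    proof -
      have "{\<omega> \<in> space ?M. t < max_hole K (\<omega> ` {..<n})} =
        (\<Union>H\<in>{H\<in>\<F>. H \<subseteq> K \<and> t < measure lebesgue H}. {\<omega> \<in> space ?M. interior H \<inter> \<omega> ` {..<n} = {}})"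
        unfolding eq by blast
      also have "\<dots> \<in> sets ?M"
        by (intro sets.countable_UN' countable_subset[OF _ cF]) (auto intro: *)
      finally show ?thesis .
    qed
  qed
  then show ?thesis
    by (subst borel_measurable_iff_greater) auto
qed

end

section \<open>Empty cells in a random sample\<close>

text \<open>Second moment method: the number \<open>X\<close> of occurring events has variance at
  most its mean \<open>card I * p\<close>, and \<open>X = 0\<close> is a deviation as large as the
  mean, to which Chebyshev applies.\<close>

lemma (in prob_space) prob_no_event_le:
  fixes p :: real
  assumes I: "finite I" and A: "\<And>i. i \<in> I \<Longrightarrow> A i \<in> events" "\<And>i. i \<in> I \<Longrightarrow> prob (A i) = p"
    and neg: "\<And>i j. i \<in> I \<Longrightarrow> j \<in> I \<Longrightarrow> i \<noteq> j \<Longrightarrow> prob (A i \<inter> A j) \<le> p\<^sup>2"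
    and p: "p > 0" "I \<noteq> {}"
  shows "prob (space M - (\<Union>i\<in>I. A i)) \<le> 1 / (card I * p)"
proof -
  define X where "X x = (\<Sum>i\<in>I. indicat_real (A i) x)" for x
  have ev [measurable]: "A i \<in> events" if "i \<in> I" for i
    using A that by auto
  have X [measurable]: "random_variable borel X"
    unfolding X_def by (intro borel_measurable_sum borel_measurable_indicator) (use A in auto)
  have X2: "X x ^ 2 = (\<Sum>i\<in>I. \<Sum>j\<in>I. indicat_real (A i \<inter> A j) x)" for x
    by (simp add: X_def power2_eq_square sum_product indicator_inter_arith)
  have int: "integrable M (indicat_real (A i \<inter> A j))" if "i \<in> I" "j \<in> I" for i j
    using that by (intro integrable_real_indicator) (auto simp: emeasure_eq_measure)
  have int2: "integrable M (\<lambda>x. X x ^ 2)"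
    unfolding X2 by (intro Bochner_Integration.integrable_sum int)
  have E: "expectation X = card I * p"
    unfolding X_def using A
    by (subst Bochner_Integration.integral_sum) (auto simp: emeasure_eq_measure)
  have "expectation (\<lambda>x. X x ^ 2) = (\<Sum>i\<in>I. \<Sum>j\<in>I. prob (A i \<inter> A j))"
    unfolding X2
    by (subst Bochner_Integration.integral_sum, intro Bochner_Integration.integrable_sum int, assumption+,
        intro sum.cong refl, subst Bochner_Integration.integral_sum, intro int, assumption+)
       (auto intro!: sum.cong)
  \<comment> \<open>A diagonal term is \<open>p\<close>, bounded crudely by
    \<open>p\<^sup>2 + p\<close>, so that the \<open>p\<^sup>2\<close> terms add up to exactly the
    squared mean, which the variance subtracts.\<close>
  also have "\<dots> \<le> (\<Sum>i\<in>I. \<Sum>j\<in>I. p\<^sup>2 + (if i = j then p else 0))"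
    using A neg p by (intro sum_mono) (auto simp: add_increasing)
  also have "\<dots> = (card I * p)\<^sup>2 + card I * p"
    using I by (simp add: sum.distrib power2_eq_square algebra_simps)
  finally have V: "variance X \<le> card I * p"
    using int2 X by (subst variance_eq) (auto simp: E intro: square_integrable_imp_integrable)
  have cp: "card I * p > 0"
    using p I by (simp add: card_gt_0_iff)
  have "prob (space M - (\<Union>i\<in>I. A i)) \<le> prob {x \<in> space M. \<bar>X x - expectation X\<bar> \<ge> card I * p}"
  proof (rule finite_measure_mono)
    show "space M - (\<Union>i\<in>I. A i) \<subseteq> {x \<in> space M. \<bar>X x - expectation X\<bar> \<ge> card I * p}"
      using cp by (auto simp: X_def E)
  qed measurable
  also have "\<dots> \<le> variance X / (card I * p)\<^sup>2"
    by (rule Chebyshev_inequality[OF X int2 cp])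
  also have "\<dots> \<le> (card I * p) / (card I * p)\<^sup>2"
    using V by (intro divide_right_mono) auto
  also have "\<dots> = 1 / (card I * p)"
    using cp by (simp add: power2_eq_square)
  finally show ?thesis .
qed

section \<open>Cells avoided by independent samples\<close>

lemma (in prob_space) avoid_in_sets:
  fixes n :: nat
  assumes "S \<in> events"
  shows "{\<omega> \<in> space (PiM {..<n} (\<lambda>_. M)). \<forall>i<n. \<omega> i \<notin> S} \<in> sets (PiM {..<n} (\<lambda>_. M))"
proof -
  have "{\<omega> \<in> space (PiM {..<n} (\<lambda>_. M)). \<forall>i<n. \<omega> i \<notin> S} = PiE {..<n} (\<lambda>_. space M - S)"
    by (auto simp: space_PiM PiE_iff extensional_def)
  then show ?thesis
    using assms by (auto intro!: sets_PiM_I_finite)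
qed

lemma (in prob_space) prob_avoid:
  fixes n :: nat
  assumes "S \<in> events"
  shows "measure (PiM {..<n} (\<lambda>_. M)) {\<omega> \<in> space (PiM {..<n} (\<lambda>_. M)). \<forall>i<n. \<omega> i \<notin> S} = (1 - prob S) ^ n"
proof -
  interpret P: product_prob_space "\<lambda>_. M" "{..<n}" ..
  have "{\<omega> \<in> space (PiM {..<n} (\<lambda>_. M)). \<forall>i<n. \<omega> i \<notin> S} = PiE {..<n} (\<lambda>_. space M - S)"
    by (auto simp: space_PiM PiE_iff extensional_def)
  moreover have "emeasure (PiM {..<n} (\<lambda>_. M)) (PiE {..<n} (\<lambda>_. space M - S)) = ennreal ((1 - prob S) ^ n)"
    using assms by (subst P.emeasure_PiM) (auto simp: emeasure_eq_measure prob_compl ennreal_power)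
  ultimately show ?thesis
    by (simp only: measure_eq_emeasure_eq_ennreal prob_le_1 diff_ge_0_iff_ge zero_le_power)
qed

text \<open>Each cell is avoided with probability \<open>(1 - a) ^ n\<close>. Two disjoint cells are
  both avoided with probability \<open>(1 - 2 * a) ^ n\<close>, at most the square of that, which is
  the negative correlation the second moment bound asks for.\<close>

lemma (in prob_space) prob_none_avoided_le:
  fixes n :: nat and a :: real
  assumes I: "finite I" "I \<noteq> {}" and S: "\<And>i. i \<in> I \<Longrightarrow> S i \<in> events" "\<And>i. i \<in> I \<Longrightarrow> prob (S i) = a"
    and disj: "disjoint_family_on S I" and a: "a < 1"
  shows "measure (PiM {..<n} (\<lambda>_. M)) {\<omega> \<in> space (PiM {..<n} (\<lambda>_. M)). \<forall>k\<in>I. \<exists>i<n. \<omega> i \<in> S k}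
           \<le> 1 / (card I * (1 - a) ^ n)"
proof -
  interpret P: product_prob_space "\<lambda>_. M" "{..<n}" ..
  let ?P = "PiM {..<n} (\<lambda>_. M)"
  define A where "A k = {\<omega> \<in> space ?P. \<forall>i<n. \<omega> i \<notin> S k}" for k
  have "{\<omega> \<in> space ?P. \<forall>k\<in>I. \<exists>i<n. \<omega> i \<in> S k} = space ?P - (\<Union>k\<in>I. A k)"
    by (auto simp: A_def)
  moreover have "measure ?P (space ?P - (\<Union>k\<in>I. A k)) \<le> 1 / (card I * (1 - a) ^ n)"
  proof (rule prob_space.prob_no_event_le[OF P.prob_space_axioms])
    fix k l assume kl: "k \<in> I" "l \<in> I" "k \<noteq> l"
    have "S k \<inter> S l = {}"
      using disj kl by (auto simp: disjoint_family_on_def)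
    then have m: "prob (S k \<union> S l) = a + a"
      using kl S by (subst finite_measure_Union) auto
    have "A k \<inter> A l = {\<omega> \<in> space ?P. \<forall>i<n. \<omega> i \<notin> S k \<union> S l}"
      by (auto simp: A_def)
    then have "measure ?P (A k \<inter> A l) = (1 - (a + a)) ^ n"
      using prob_avoid[of "S k \<union> S l" n] m S kl by simp
    \<comment> \<open>Monotonicity of powers needs \<open>1 - 2 * a \<ge> 0\<close>, which holds
      since \<open>2 * a\<close> is the probability of the union.\<close>
    also have "\<dots> \<le> ((1 - a)\<^sup>2) ^ n"
      using m prob_le_1[of "S k \<union> S l"] by (intro power_mono) (auto simp: power2_eq_square algebra_simps)
    finally show "measure ?P (A k \<inter> A l) \<le> ((1 - a) ^ n)\<^sup>2"
      by (simp add: power_mult[symmetric] mult.commute)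
  qed (use I S a prob_avoid avoid_in_sets in \<open>auto simp: A_def\<close>)
  ultimately show ?thesis
    by simp
qed

text \<open>Without atoms the distribution function is continuous, so the intermediate value theorem
  applies between its limits 0 and 1.\<close>

lemma (in real_distribution) ex_quantile:
  assumes atomless: "\<And>x. prob {x} = 0" and y: "0 < y" "y < 1"
  shows "\<exists>x. cdf M x = y"
proof -
  obtain b where b: "cdf M b > y"
    using order_tendstoD(1)[OF cdf_lim_at_top_prob y(2)] by (auto simp: eventually_at_top_linorder)
  obtain a where a: "cdf M a < y"
    using order_tendstoD(2)[OF cdf_lim_at_bot y(1)] by (auto simp: eventually_at_bot_linorder)
  have "a \<le> b"
    using a b cdf_nondecreasing[of b a] by (cases "a \<le> b") auto
  then show ?thesis
    using IVT[of "cdf M" a y b] a b isCont_cdf atomless by force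
qed

text \<open>The cut points are the quantiles of levels \<open>a, 2 * a, ..., (m + 1) * a\<close>.
  Levels 0 and 1 are avoided because no real number need attain them; this is why \<open>m\<close>
  intervals require room for \<open>m + 1\<close>.\<close>

lemma (in real_distribution) equal_mass_intervals:
  assumes atomless: "\<And>x. prob {x} = 0" and a: "0 < a" and m: "(real m + 1) * a < 1"
  obtains t :: "nat \<Rightarrow> real"
  where "\<And>k. k < m \<Longrightarrow> prob {t k<..t (Suc k)} = a" "disjoint_family_on (\<lambda>k. {t k<..t (Suc k)}) {..<m}"
proof -
  have "\<exists>x. k \<le> m \<longrightarrow> cdf M x = (real k + 1) * a" for k :: nat
  proof (cases "k \<le> m")
    case True
    then have "(real k + 1) * a \<le> (real m + 1) * a"
      using a by (intro mult_right_mono) auto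
    moreover have "0 < (real k + 1) * a"
      using a by (intro mult_pos_pos) auto
    ultimately show ?thesis
      using ex_quantile[OF atomless, of "(real k + 1) * a"] m by (meson le_less_trans)
  qed auto
  then obtain t where t: "\<And>k. k \<le> m \<Longrightarrow> cdf M (t k) = (real k + 1) * a"
    by metis
  have less: "t k < t l" if "k < l" "l \<le> m" for k l
  proof -
    have "cdf M (t k) < cdf M (t l)"
      using that t a by simp
    then show ?thesis
      using cdf_nondecreasing[of "t l" "t k"] by force
  qed
  show ?thesis
  proof
    fix k assume k: "k < m"
    show "prob {t k<..t (Suc k)} = a"
      using cdf_diff_eq[of "t k" "t (Suc k)"] less[of k "Suc k"] k t[of k] t[of "Suc k"]
      by (auto simp: algebra_simps)
  next
    have "t (Suc k) \<le> t l" if "k < l" "l < m" for k l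
      using less[of "Suc k" l] that by (cases "Suc k = l") auto
    then show "disjoint_family_on (\<lambda>k. {t k<..t (Suc k)}) {..<m}"
      by (fastforce simp: disjoint_family_on_def neq_iff)
  qed
qed

section \<open>The lower bound\<close>

locale unit_area_body =
  fixes K :: "(real^2) set"
  assumes convex_K: "convex K" and emeasure_K: "emeasure lebesgue K = 1"
begin

abbreviation M :: "(real^2) measure" where
  "M \<equiv> uniform_measure lebesgue K"

lemma K_lmeasurable: "K \<in> lmeasurable"
  using emeasure_K convex_sets_lebesgue[OF convex_K] by (auto simp: fmeasurable_def)

sublocale M: prob_space M
  using emeasure_K by (intro prob_space_uniform_measure) auto

lemma measure_M: "B \<in> sets lebesgue \<Longrightarrow> measure M B = measure lebesgue (K \<inter> B)"
proof -
  have "measure lebesgue K = 1"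
    using emeasure_K by (simp only: measure_def enn2real_1)
  then show "B \<in> sets lebesgue \<Longrightarrow> measure M B = measure lebesgue (K \<inter> B)"
    using emeasure_K by (subst measure_uniform_measure) simp_all
qed

lemma measure_M_subset: "B \<in> sets lebesgue \<Longrightarrow> B \<subseteq> K \<Longrightarrow> measure M B = measure lebesgue B"
  by (simp add: measure_M Int_absorb1)

lemma measurable_M_borel: "f \<in> borel_measurable borel \<Longrightarrow> f \<in> borel_measurable M"
  by (subst measurable_cong_sets[of M lebesgue]) (auto intro: measurable_completion)

sublocale P: prob_space "uniform_points K n" for n
proof -
  interpret P: product_prob_space "\<lambda>_. M" "{..<n}" ..
  show "prob_space (uniform_points K n)"
    unfolding uniform_points_def by (rule P.prob_space_axioms)
qed

lemma borel_measurable_max_hole [measurable]: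
  "(\<lambda>\<omega>. max_hole K (\<omega> ` {..<n})) \<in> borel_measurable (uniform_points K n)"
  by (rule measurable_max_hole[OF K_lmeasurable])

text \<open>Quantiles of the first coordinate cut \<open>m\<close> disjoint slabs of area
  \<open>a\<close> out of \<open>K\<close>. Each is convex, so one without sample points is a hole
  of area \<open>a\<close>; hence \<open>max_hole\<close> can be below \<open>a\<close> only if
  every slab is hit.\<close>

lemma prob_max_hole_less_le:
  assumes a: "0 < a" "(real m + 1) * a < 1" and m: "0 < m"
  shows "P.prob n {\<omega> \<in> space (uniform_points K n). max_hole K (\<omega> ` {..<n}) < a}
           \<le> 1 / (m * (1 - a) ^ n)"
proof -
  define D where "D = distr M borel (\<lambda>x. x $ 1)"
  have m1: "(\<lambda>x::real^2. x $ 1) \<in> borel_measurable borel"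
    by (intro borel_measurable_continuous_onI continuous_intros)
  have "prob_space D"
    unfolding D_def by (intro M.prob_space_distr measurable_M_borel m1)
  then interpret D: real_distribution D
    by (simp add: real_distribution_def real_distribution_axioms_def D_def)
  have mD: "measure D X = measure M {x. x $ 1 \<in> X}" if "X \<in> sets borel" for X
    unfolding D_def using that
    by (subst measure_distr[OF measurable_M_borel[OF m1]]) (auto simp: vimage_def)
  \<comment> \<open>An atom would be a vertical line of positive area.\<close>
  have atomless: "measure D {c} = 0" for c
  proof -
    have "negligible {x::real^2. axis 1 1 \<bullet> x = c}"
      by (rule negligible_hyperplane) (simp add: axis_eq_0_iff)
    then have "negligible {x::real^2. x $ 1 = c}"
      by (simp add: inner_axis')
    then have "{x::real^2. x $ 1 = c} \<in> null_sets lebesgue"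
      by (simp add: negligible_iff_null_sets)
    then have null: "{x::real^2. x $ 1 = c} \<inter> K \<in> null_sets lebesgue"
      and meas: "{x::real^2. x $ 1 = c} \<in> sets lebesgue"
      using null_set_Int2[OF _ convex_sets_lebesgue[OF convex_K]] null_setsD2 by auto
    have "measure D {c} = measure M {x. x $ 1 \<in> {c}}"
      by (rule mD) simp
    also have "\<dots> = measure M {x. x $ 1 = c}"
      by simp
    also have "\<dots> = measure lebesgue ({x. x $ 1 = c} \<inter> K)"
      using measure_M[OF meas] by (simp only: Int_commute)
    also have "\<dots> = 0"
      by (rule measure_eq_0_null_sets[OF null])
    finally show ?thesis .
  qed
  obtain t :: "nat \<Rightarrow> real" where t: "\<And>k. k < m \<Longrightarrow> measure D {t k<..t (Suc k)} = a"
      "disjoint_family_on (\<lambda>k. {t k<..t (Suc k)}) {..<m}"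
    by (rule D.equal_mass_intervals[OF atomless a]) blast
  define S where "S k = K \<inter> {x. t k < x $ 1 \<and> x $ 1 \<le> t (Suc k)}" for k
  have convex_slab: "convex {x::real^2. t k < x $ 1 \<and> x $ 1 \<le> t (Suc k)}" for k
  proof -
    have "convex ({x::real^2. axis 1 1 \<bullet> x > t k} \<inter> {x. axis 1 1 \<bullet> x \<le> t (Suc k)})"
      by (intro convex_Int convex_halfspace_gt convex_halfspace_le)
    then show ?thesis
      by (rule back_subst[of convex]) (auto simp: inner_axis')
  qed
  have convex_S: "convex (S k)" for k
    unfolding S_def by (intro convex_Int convex_K convex_slab)
  have area_S: "measure lebesgue (S k) = a" if "k < m" for k
    using t(1)[OF that] convex_sets_lebesgue[OF convex_slab[of k]] by (simp add: mD measure_M S_def)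
  have meas_S: "measure M (S k) = a" if "k < m" for k
    using area_S[OF that] convex_sets_lebesgue[OF convex_S] by (subst measure_M_subset) (auto simp: S_def)
  have disj: "disjoint_family_on S {..<m}"
    unfolding disjoint_family_on_def
  proof (intro ballI impI equals0I)
    fix k l x assume kl: "k \<in> {..<m}" "l \<in> {..<m}" "k \<noteq> l" and "x \<in> S k \<inter> S l"
    then have "x $ 1 \<in> {t k<..t (Suc k)} \<inter> {t l<..t (Suc l)}"
      by (auto simp: S_def)
    then show False
      unfolding disjoint_family_onD[OF t(2) kl] by simp
  qed
  have "{\<omega> \<in> space (uniform_points K n). max_hole K (\<omega> ` {..<n}) < a} \<subseteq>
        {\<omega> \<in> space (uniform_points K n). \<forall>k\<in>{..<m}. \<exists>i<n. \<omega> i \<in> S k}"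
  proof (intro subsetI CollectI conjI ballI; elim CollectE conjE)
    fix \<omega> k assume *: "max_hole K (\<omega> ` {..<n}) < a" "k \<in> {..<m}"
    show "\<exists>i<n. \<omega> i \<in> S k"
    proof (rule ccontr)
      assume "\<not> (\<exists>i<n. \<omega> i \<in> S k)"
      then have "hole K (\<omega> ` {..<n}) (S k)"
        using interior_subset[of "S k"] by (auto simp: hole_def S_def)
      then show False
        using measure_le_max_hole[OF K_lmeasurable convex_S] area_S * by fastforce
    qed
  qed
  moreover have "{\<omega> \<in> space (uniform_points K n). \<forall>k\<in>{..<m}. \<exists>i<n. \<omega> i \<in> S k} \<in> P.events n"
  proof -
    have "{\<omega> \<in> space (uniform_points K n). \<forall>k\<in>{..<m}. \<exists>i<n. \<omega> i \<in> S k} =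
      space (uniform_points K n) - (\<Union>k<m. {\<omega> \<in> space (uniform_points K n). \<forall>i<n. \<omega> i \<notin> S k})"
      by auto
    moreover have "{\<omega> \<in> space (uniform_points K n). \<forall>i<n. \<omega> i \<notin> S k} \<in> P.events n" for k
      unfolding uniform_points_def using M.avoid_in_sets convex_sets_lebesgue[OF convex_S] by simp
    ultimately show ?thesis
      by (simp only: sets.Diff sets.top sets.finite_UN finite_lessThan)
  qed
  ultimately have "P.prob n {\<omega> \<in> space (uniform_points K n). max_hole K (\<omega> ` {..<n}) < a} \<le>
      P.prob n {\<omega> \<in> space (uniform_points K n). \<forall>k\<in>{..<m}. \<exists>i<n. \<omega> i \<in> S k}"
    by (rule P.finite_measure_mono)
  also have "\<dots> \<le> 1 / (card {..<m} * (1 - a) ^ n)"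
    unfolding uniform_points_def
  proof (rule M.prob_none_avoided_le)
    have "1 * a \<le> (real m + 1) * a"
      using a by (intro mult_right_mono) auto
    then show "a < 1"
      using a by linarith
  qed (use m meas_S disj convex_sets_lebesgue[OF convex_S] in auto)
  finally show ?thesis
    by simp
qed

text \<open>With \<open>a n = c * ln n / n\<close> there are about \<open>1 / a n\<close> slabs,
  each empty with probability about \<open>n powr (-c)\<close>; for \<open>0 < c < 1\<close> the
  expected number of empty ones tends to infinity.\<close>

lemma max_hole_lower_bound:
  assumes c: "c < 1"
  shows "(\<lambda>n. P.prob n {\<omega> \<in> space (uniform_points K n).
            max_hole K (\<omega> ` {..<n}) < c * (ln (real n) / real n)}) \<longlonglongrightarrow> 0"
proof (cases "c > 0")
  case False
  have "{\<omega> \<in> space (uniform_points K n). max_hole K (\<omega> ` {..<n}) < c * (ln (real n) / real n)} = {}" for n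
  proof -
    \<comment> \<open>For \<open>n = 0\<close> this is a division by zero, with value 0.\<close>
    have "ln (real n) / real n \<ge> 0"
      by (cases "n = 0") auto
    then have "c * (ln (real n) / real n) \<le> 0"
      using False by (simp add: mult_nonpos_nonneg del: times_divide_eq_right)
    then show ?thesis
      using max_hole_nonneg[OF K_lmeasurable] by (auto simp: not_less intro: order_trans)
  qed
  then show ?thesis
    by (simp only: measure_empty tendsto_const)
next
  case True
  define a where "a n = c * (ln (real n) / real n)" for n :: nat
  \<comment> \<open>Subtracting 2 makes \<open>m n + 1\<close> strictly less than
    \<open>1 / a n\<close> even when the latter is an integer. The truncated subtraction is harmless
    once \<open>1 / a n > 3\<close>.\<close>
  define m where "m n = nat \<lfloor>1 / a n\<rfloor> - 2" for n
  have "filterlim (\<lambda>n. (1 / a n - 3) * (1 - a n) ^ n) at_top at_top"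
    unfolding a_def using c True by real_asymp
  then have lim: "(\<lambda>n. 1 / ((1 / a n - 3) * (1 - a n) ^ n)) \<longlonglongrightarrow> 0"
    by (intro tendsto_divide_0[OF tendsto_const] filterlim_at_top_imp_at_infinity)
  have "filterlim (\<lambda>n. 1 / a n) at_top at_top"
    unfolding a_def using c True by real_asymp
  then have "eventually (\<lambda>n. 1 / a n > 3) at_top"
    by (simp add: filterlim_at_top_dense)
  then have "eventually (\<lambda>n. P.prob n {\<omega> \<in> space (uniform_points K n). max_hole K (\<omega> ` {..<n}) < a n}
       \<le> 1 / ((1 / a n - 3) * (1 - a n) ^ n)) at_top"
  proof eventually_elim
    case (elim n)
    then have an: "a n > 0"
      by (metis less_trans zero_less_divide_1_iff zero_less_numeral)
    have fl: "\<lfloor>1 / a n\<rfloor> \<ge> 3"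
      using elim by linarith
    then have "int (m n) = \<lfloor>1 / a n\<rfloor> - 2"
      unfolding m_def by arith
    then have mr: "real (m n) = real_of_int \<lfloor>1 / a n\<rfloor> - 2"
      by linarith
    have "real (m n) + 1 < 1 / a n" "real (m n) \<ge> 1 / a n - 3"
      unfolding mr by linarith+
    have mpos: "0 < m n"
      using mr fl by linarith
    have "(real (m n) + 1) * a n < 1"
      using an \<open>real (m n) + 1 < 1 / a n\<close> by (simp add: less_divide_eq)
    then have "P.prob n {\<omega> \<in> space (uniform_points K n). max_hole K (\<omega> ` {..<n}) < a n}
       \<le> 1 / (m n * (1 - a n) ^ n)"
      by (rule prob_max_hole_less_le[OF an _ mpos])
    also have "\<dots> \<le> 1 / ((1 / a n - 3) * (1 - a n) ^ n)"
    proof -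
      have "a n < 1"
        using elim an by (simp add: field_simps)
      then show ?thesis
        using elim \<open>real (m n) \<ge> 1 / a n - 3\<close> by (intro divide_left_mono mult_right_mono mult_pos_pos) auto
    qed
    finally show ?case .
  qed
  then show ?thesis
    unfolding a_def[symmetric]
    by (rule tendsto_sandwich[OF _ _ tendsto_const lim, rotated]) (simp_all add: measure_nonneg)
qed

end

section \<open>Affine frames of convex sets\<close>

text \<open>Shrink \<open>C\<close> towards \<open>c\<close> by the factor \<open>1 - d\<close>. The
  copy \<open>C'\<close> keeps the proportion \<open>(1 - d) ^ DIM('a)\<close> of the measure, and
  its distance to the outside of \<open>C\<close> is at least \<open>d * r\<close>. The balls of a
  fine finite net of \<open>B\<close> that meet \<open>C'\<close> therefore have a union between
  \<open>C'\<close> and \<open>C\<close>, and there are only finitely many such unions, whatever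
  \<open>C\<close> is.\<close>

lemma finite_inner_approx_family:
  fixes B :: "'a::euclidean_space set"
  assumes B: "bounded B" and d: "0 < d" "d < 1" and r: "0 < r"
  obtains \<S> where "finite \<S>" "\<forall>S\<in>\<S>. open S \<and> bounded S"
    "\<forall>C c. convex C \<and> C \<subseteq> B \<and> ball c r \<subseteq> C \<longrightarrow>
       (\<exists>S\<in>\<S>. S \<subseteq> C \<and> (1 - d) ^ DIM('a) * measure lebesgue C \<le> measure lebesgue S)"
proof -
  \<comment> \<open>Every point of a ball of radius \<open>e\<close> that meets \<open>C'\<close> is
    within \<open>2 * e = d * r\<close> of \<open>C'\<close>.\<close>
  define e where "e = d * r / 2"
  have e: "e > 0"
    using d r by (simp add: e_def)
  have "compact (closure B)"
    using B by simp
  then obtain k where k: "finite k" "closure B \<subseteq> (\<Union>x\<in>k. ball x e)"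
    using seq_compact_imp_totally_bounded[of "closure B"] e by (auto simp: compact_imp_seq_compact)
  define \<S> where "\<S> = (\<lambda>F. \<Union>x\<in>F. ball x e) ` Pow k"
  show ?thesis
  proof
    show "finite \<S>"
      using k by (simp add: \<S>_def)
    show ob: "\<forall>S\<in>\<S>. open S \<and> bounded S"
      using k(1) by (auto simp: \<S>_def bounded_UN finite_subset)
    show "\<forall>C c. convex C \<and> C \<subseteq> B \<and> ball c r \<subseteq> C \<longrightarrow>
       (\<exists>S\<in>\<S>. S \<subseteq> C \<and> (1 - d) ^ DIM('a) * measure lebesgue C \<le> measure lebesgue S)"
    proof (intro allI impI, elim conjE)
      fix C and c :: 'a
      assume C: "convex C" "C \<subseteq> B" and c: "ball c r \<subseteq> C"
      define C' where "C' = (\<lambda>x. (1 - d) *\<^sub>R x + d *\<^sub>R c) ` C"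
      have cC: "c \<in> C"
        using c r by auto
      have C'C: "C' \<subseteq> C"
        using convexD[OF C(1) _ cC, of _ "1 - d" d] d by (auto simp: C'_def)
      define S where "S = (\<Union>x\<in>{x\<in>k. ball x e \<inter> C' \<noteq> {}}. ball x e)"
      have S: "S \<in> \<S>"
        by (auto simp: S_def \<S>_def)
      have "S \<subseteq> C"
      proof
        fix y assume "y \<in> S"
        then obtain x h where x: "dist x y < e" "dist x ((1 - d) *\<^sub>R h + d *\<^sub>R c) < e" "h \<in> C"
          by (auto simp: S_def C'_def)
        define z where "z = (1 - d) *\<^sub>R h + d *\<^sub>R c"
        have "dist y z < d * r"
          using x dist_triangle_half_r[of x y "d * r" z] by (simp add: e_def z_def)
        then have "norm ((1 / d) *\<^sub>R (y - z)) < r"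
          using d unfolding norm_scaleR by (simp add: dist_norm divide_less_eq mult.commute)
        then have "dist c (c + (1 / d) *\<^sub>R (y - z)) < r"
          unfolding dist_norm by (metis add_diff_cancel_left' norm_minus_commute)
        then have "c + (1 / d) *\<^sub>R (y - z) \<in> C"
          using c by auto
        \<comment> \<open>The displacement \<open>y - z\<close> is absorbed into the centre:
          \<open>y\<close> combines \<open>h\<close> with a point of the ball around
          \<open>c\<close>, with weights \<open>1 - d\<close> and \<open>d\<close>.\<close>
        from convexD[OF C(1) x(3) this, of "1 - d" d] show "y \<in> C"
          using d by (simp add: z_def algebra_simps)
      qed
      moreover have "C' \<subseteq> S"
      proof
        fix y assume y: "y \<in> C'"
        then have "y \<in> (\<Union>x\<in>k. ball x e)"
          using C'C C(2) closure_subset[of B] k(2) by blast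
        then show "y \<in> S"
          unfolding S_def using y by blast
      qed
      then have "measure lebesgue C' \<le> measure lebesgue S"
      proof (rule measure_mono_fmeasurable)
        have "convex ((\<lambda>x. d *\<^sub>R c + (1 - d) *\<^sub>R x) ` C)"
          by (rule convex_affinity[OF C(1)])
        then show "C' \<in> sets lebesgue"
          by (intro convex_sets_lebesgue) (simp add: C'_def add.commute)
        show "S \<in> lmeasurable"
          using ob S by (intro lmeasurable_open) auto
      qed
      moreover have "measure lebesgue C' = (1 - d) ^ DIM('a) * measure lebesgue C"
        using measure_lebesgue_affine[of "1 - d" "d *\<^sub>R c" C] d by (simp add: C'_def)
      ultimately show "\<exists>S\<in>\<S>. S \<subseteq> C \<and> (1 - d) ^ DIM('a) * measure lebesgue C \<le> measure lebesgue S"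
        using S by auto
    qed
  qed
qed

text \<open>Twice the signed area of the triangle \<open>p q r\<close>.\<close>

definition det3 :: "real^2 \<Rightarrow> real^2 \<Rightarrow> real^2 \<Rightarrow> real" where
  "det3 p q r = (q $ 1 - p $ 1) * (r $ 2 - p $ 2) - (q $ 2 - p $ 2) * (r $ 1 - p $ 1)"

definition from_frame :: "real^2 \<Rightarrow> real^2 \<Rightarrow> real^2 \<Rightarrow> real^2 \<Rightarrow> real^2" where
  "from_frame p q r x = p + (x $ 1 *\<^sub>R (q - p) + x $ 2 *\<^sub>R (r - p))"

text \<open>Cramer's rule for inverting \<open>from_frame p q r\<close>. Writing coordinates as
  quotients of triangle areas makes them easy to bound by a triangle of near-maximal area.\<close>

definition to_frame :: "real^2 \<Rightarrow> real^2 \<Rightarrow> real^2 \<Rightarrow> real^2 \<Rightarrow> real^2" where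
  "to_frame p q r y = (det3 p y r / det3 p q r) *\<^sub>R axis 1 1 + (det3 p q y / det3 p q r) *\<^sub>R axis 2 1"

lemma to_frame_nth [simp]:
  "to_frame p q r y $ 1 = det3 p y r / det3 p q r" "to_frame p q r y $ 2 = det3 p q y / det3 p q r"
  by (simp_all add: to_frame_def axis_def)

lemma from_frame_nth [simp]:
  "from_frame p q r x $ i = p $ i + (x $ 1 * (q $ i - p $ i) + x $ 2 * (r $ i - p $ i))"
  by (simp add: from_frame_def)

lemma to_frame_from_frame: "det3 p q r \<noteq> 0 \<Longrightarrow> to_frame p q r (from_frame p q r x) = x"
  by (simp add: vec_eq_iff forall_2 divide_eq_eq) (simp add: det3_def algebra_simps)

lemma from_frame_to_frame: "det3 p q r \<noteq> 0 \<Longrightarrow> from_frame p q r (to_frame p q r y) = y"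
  by (simp add: vec_eq_iff forall_2 field_simps) (simp add: det3_def algebra_simps)

text \<open>Serves both to show that frame coordinates are affine and to move the vertices of a
  triangle one at a time.\<close>

lemma det3_affine:
  "det3 ((1 - d) *\<^sub>R p + d *\<^sub>R p') q r = (1 - d) * det3 p q r + d * det3 p' q r"
  "det3 p ((1 - d) *\<^sub>R q + d *\<^sub>R q') r = (1 - d) * det3 p q r + d * det3 p q' r"
  "det3 p q ((1 - d) *\<^sub>R r + d *\<^sub>R r') = (1 - d) * det3 p q r + d * det3 p q r'"
  by (simp_all add: det3_def algebra_simps)

text \<open>The map is a translate of the linear map with columns \<open>q - p\<close> and
  \<open>r - p\<close>, whose determinant is \<open>det3 p q r\<close>.\<close>

lemma from_frame_image:
  assumes "S \<in> lmeasurable"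
  shows "from_frame p q r ` S \<in> lmeasurable"
    and "measure lebesgue (from_frame p q r ` S) = \<bar>det3 p q r\<bar> * measure lebesgue S"
proof -
  define f where "f x = x $ 1 *\<^sub>R (q - p) + x $ 2 *\<^sub>R (r - p)" for x :: "real^2"
  have f: "linear f"
    unfolding f_def by (intro linearI) (auto simp: algebra_simps)
  have "det (matrix f) = det3 p q r"
    by (simp add: matrix_def det_2 f_def axis_def det3_def)
  moreover have "from_frame p q r ` S = (+) p ` (f ` S)"
    by (auto simp: from_frame_def f_def image_image)
  ultimately show "from_frame p q r ` S \<in> lmeasurable"
    "measure lebesgue (from_frame p q r ` S) = \<bar>det3 p q r\<bar> * measure lebesgue S"
    using measurable_linear_image[OF f assms] measure_linear_image[OF f assms]
    by (simp_all add: measurable_translation measure_translation)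
qed

lemma convex_to_frame_image:
  assumes "convex H"
  shows "convex (to_frame p q r ` H)"
proof (rule convexI)
  fix x y :: "real^2" and u v :: real
  assume xy: "x \<in> to_frame p q r ` H" "y \<in> to_frame p q r ` H" and uv: "0 \<le> u" "0 \<le> v" "u + v = 1"
  then obtain a b where ab: "a \<in> H" "x = to_frame p q r a" "b \<in> H" "y = to_frame p q r b"
    by auto
  have u: "u = 1 - v"
    using uv by simp
  have "to_frame p q r (u *\<^sub>R a + v *\<^sub>R b) = u *\<^sub>R x + v *\<^sub>R y"
    unfolding ab u by (simp add: vec_eq_iff forall_2 det3_affine add_divide_distrib)
  then show "u *\<^sub>R x + v *\<^sub>R y \<in> to_frame p q r ` H"
    using convexD[OF assms ab(1,3) uv] by (metis imageI)
qed

text \<open>Both coordinates of a point of this ball lie strictly between 0 and 1/2, so they are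
  positive with sum below 1.\<close>

lemma ball_subset_convex_simplex:
  fixes C :: "(real^2) set"
  assumes C: "convex C" and "0 \<in> C" "axis 1 1 \<in> C" "axis 2 1 \<in> C"
  shows "ball (\<chi> i. 1/4) (1/4) \<subseteq> C"
proof
  fix y :: "real^2" assume y: "y \<in> ball (\<chi> i. 1/4) (1/4)"
  have *: "\<bar>y $ i - 1/4\<bar> < 1/4" for i
    using component_le_norm_cart[of "y - (\<chi> i. 1/4)" i] y by (simp add: dist_norm norm_minus_commute)
  have "y $ 1 > 0" "y $ 2 > 0" "y $ 1 + y $ 2 < 1"
    using *[of 1] *[of 2] by linarith+
  then have "0 + y $ 1 *\<^sub>R (axis 1 1 - 0) + y $ 2 *\<^sub>R (axis 2 1 - 0) \<in> convex hull {0, axis 1 1, axis 2 1}"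
    unfolding convex_hull_3_alt
    by (intro CollectI exI[of _ "y $ 1"] exI[of _ "y $ 2"] conjI refl) linarith+
  also have "0 + y $ 1 *\<^sub>R (axis 1 1 - 0) + y $ 2 *\<^sub>R (axis 2 1 - 0) = y"
    by (simp add: vec_eq_iff forall_2 axis_def)
  also have "convex hull {0, axis 1 1, axis 2 1} \<subseteq> C"
    using assms by (intro hull_minimal) auto
  finally show "y \<in> C" .
qed

lemma frame_vertices:
  assumes "det3 p q r \<noteq> 0"
  shows "to_frame p q r p = 0" "to_frame p q r q = axis 1 1" "to_frame p q r r = axis 2 1"
  using assms by (simp_all add: vec_eq_iff forall_2 axis_def) (simp_all add: det3_def)

lemma ball_subset_to_frame_image:
  assumes "convex H" "p \<in> H" "q \<in> H" "r \<in> H" "det3 p q r \<noteq> 0"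
  shows "ball (\<chi> i. 1/4) (1/4) \<subseteq> to_frame p q r ` H"
proof (rule ball_subset_convex_simplex[OF convex_to_frame_image[OF assms(1)]])
  show "0 \<in> to_frame p q r ` H" "axis 1 1 \<in> to_frame p q r ` H" "axis 2 1 \<in> to_frame p q r ` H"
    unfolding frame_vertices[OF assms(5), symmetric] by (intro imageI assms)+
qed

text \<open>Boundedness of \<open>H\<close> is not assumed, so the bound comes from area: a fixed
  ball inside the standard simplex is mapped into \<open>H\<close> by the frame, and its area is
  multiplied by \<open>\<bar>det3 p q r\<bar>\<close>.\<close>

lemma det3_bounded:
  assumes H: "convex H" "H \<in> lmeasurable"
  obtains b where "\<And>p q r. p \<in> H \<Longrightarrow> q \<in> H \<Longrightarrow> r \<in> H \<Longrightarrow> \<bar>det3 p q r\<bar> \<le> b"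
proof
  define T :: "(real^2) set" where "T = ball (\<chi> i. 1/4) (1/4)"
  have T: "measure lebesgue T > 0"
    by (simp add: T_def content_ball_pos)
  fix p q r assume pqr: "p \<in> H" "q \<in> H" "r \<in> H"
  show "\<bar>det3 p q r\<bar> \<le> measure lebesgue H / measure lebesgue T"
  proof (cases "det3 p q r = 0")
    case False
    have "from_frame p q r ` T \<subseteq> H"
      using ball_subset_to_frame_image[OF H(1) pqr False] from_frame_to_frame[OF False]
      by (auto simp: T_def)
    moreover have Tm: "T \<in> lmeasurable"
      by (simp add: T_def)
    ultimately have "measure lebesgue (from_frame p q r ` T) \<le> measure lebesgue H"
      using from_frame_image(1)[OF Tm] H(2) by (intro measure_mono_fmeasurable) auto
    then have "\<bar>det3 p q r\<bar> * measure lebesgue T \<le> measure lebesgue H"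
      by (simp add: from_frame_image(2)[OF Tm])
    then show ?thesis
      using T by (simp add: field_simps)
  qed auto
qed

text \<open>A triangle of near-maximal area in \<open>H\<close> is an affine frame in which \<open>H\<close> has bounded
  coordinates, and this persists when each vertex is replaced by any point of a small homothetic
  copy of \<open>H\<close> at that vertex.\<close>

lemma ex_many_good_frames:
  assumes H: "convex H" "H \<in> lmeasurable" "measure lebesgue H > 0"
  obtains P Q R where "P \<subseteq> H" "Q \<subseteq> H" "R \<subseteq> H"
    "P \<in> sets lebesgue" "Q \<in> sets lebesgue" "R \<in> sets lebesgue"
    "measure lebesgue P = (1/24)\<^sup>2 * measure lebesgue H"
    "measure lebesgue Q = (1/24)\<^sup>2 * measure lebesgue H"
    "measure lebesgue R = (1/24)\<^sup>2 * measure lebesgue H"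
    "\<forall>p\<in>P. \<forall>q\<in>Q. \<forall>r\<in>R. det3 p q r \<noteq> 0 \<and> (\<forall>y\<in>H. \<forall>i. \<bar>to_frame p q r y $ i\<bar> \<le> 4)"
proof -
  obtain b where b: "\<And>p q r. p \<in> H \<Longrightarrow> q \<in> H \<Longrightarrow> r \<in> H \<Longrightarrow> \<bar>det3 p q r\<bar> \<le> b"
    using det3_bounded[OF H(1,2)] by blast
  define f where "f = (\<lambda>(p, q, r). \<bar>det3 p q r\<bar>)"
  define s where "s = (SUP x\<in>H \<times> H \<times> H. f x)"
  have bdd: "bdd_above (f ` (H \<times> H \<times> H))"
    by (rule bdd_aboveI[of _ b]) (auto simp: f_def b)
  have les: "\<bar>det3 p q r\<bar> \<le> s" if "p \<in> H" "q \<in> H" "r \<in> H" for p q r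
    using cSUP_upper[OF _ bdd, of "(p, q, r)"] that by (simp add: s_def f_def)
  have "\<exists>x. x \<in> interior H"
    using measure_interior_convex[OF H(1)] H(3) by (metis ex_in_conv less_irrefl measure_empty)
  then obtain x e where x: "ball x e \<subseteq> H" "e > 0"
    by (metis mem_interior)
  \<comment> \<open>A right triangle with legs \<open>e / 2\<close> inside a ball contained in
    \<open>H\<close> shows that the supremum is positive.\<close>
  have "\<bar>det3 x (x + (e/2) *\<^sub>R axis 1 1) (x + (e/2) *\<^sub>R axis 2 1)\<bar> \<le> s"
    using x by (intro les subsetD[OF x(1)]) (auto simp: dist_norm norm_axis_1)
  then have s: "s > 0"
    using mult_pos_pos[OF x(2) x(2)] by (auto simp: det3_def axis_def simp del: zero_less_mult_iff)
  have "H \<times> H \<times> H \<noteq> {}"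
    using x by auto
  \<comment> \<open>The supremum need not be attained, as \<open>H\<close> may fail to be closed;
    half of it is enough.\<close>
  then obtain u v w where uvw: "u \<in> H" "v \<in> H" "w \<in> H" "s / 2 < \<bar>det3 u v w\<bar>"
    using less_cSUP_iff[OF _ bdd, of "s/2"] s unfolding s_def[symmetric] by (auto simp: f_def)
  \<comment> \<open>With ratio 1/24, moving one vertex changes the determinant by at most
    \<open>2 * s / 24 = s / 12\<close>. Three moves cost \<open>s / 4\<close>, which leaves at least
    \<open>s / 4\<close>; coordinates are then quotients bounded by
    \<open>s / (s / 4) = 4\<close>.\<close>
  define g where "g z = (\<lambda>x. (1 - 1/24) *\<^sub>R z + (1/24) *\<^sub>R x) ` H" for z :: "real^2"
  have gH: "g z \<subseteq> H" if "z \<in> H" for z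
    using convexD[OF H(1) that, of _ "1 - 1/24" "1/24"] by (auto simp: g_def)
  have g_sets: "g z \<in> sets lebesgue" for z
    unfolding g_def by (intro convex_sets_lebesgue convex_affinity H)
  have g_meas: "measure lebesgue (g z) = (1/24)\<^sup>2 * measure lebesgue H" for z
    using measure_lebesgue_affine[of "1/24" "(1 - 1/24) *\<^sub>R z" H] by (simp add: g_def add.commute power_divide)
  have step: "\<bar>(1 - 1/24) * a + (1/24) * c\<bar> \<ge> \<bar>a\<bar> - s / 12" if "\<bar>a\<bar> \<le> s" "\<bar>c\<bar> \<le> s" for a c
  proof -
    have "a = ((1 - 1/24) * a + (1/24) * c) + (a - c) / 24"
      by (simp add: field_simps)
    then have "\<bar>a\<bar> \<le> \<bar>(1 - 1/24) * a + (1/24) * c\<bar> + \<bar>(a - c) / 24\<bar>"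
      using abs_triangle_ineq by metis
    moreover have "\<bar>(a - c) / 24\<bar> \<le> s / 12"
      using abs_triangle_ineq4[of a c] that by simp
    ultimately show ?thesis
      by linarith
  qed
  have det: "\<bar>det3 p q r\<bar> \<ge> s / 4" if pqr: "p \<in> g u" "q \<in> g v" "r \<in> g w" for p q r
  proof -
    obtain p' q' r' where eq: "p = (1 - 1/24) *\<^sub>R u + (1/24) *\<^sub>R p'" "q = (1 - 1/24) *\<^sub>R v + (1/24) *\<^sub>R q'"
        "r = (1 - 1/24) *\<^sub>R w + (1/24) *\<^sub>R r'" and H': "p' \<in> H" "q' \<in> H" "r' \<in> H"
      using pqr unfolding g_def by blast
    have pq: "p \<in> H" "q \<in> H"
      using that gH uvw by auto
    have "\<bar>det3 p v w\<bar> \<ge> \<bar>det3 u v w\<bar> - s / 12"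
      unfolding eq(1) det3_affine by (intro step les uvw H')
    moreover have "\<bar>det3 p q w\<bar> \<ge> \<bar>det3 p v w\<bar> - s / 12"
      unfolding eq(2) det3_affine by (intro step les uvw H' pq)
    moreover have "\<bar>det3 p q r\<bar> \<ge> \<bar>det3 p q w\<bar> - s / 12"
      unfolding eq(3) det3_affine by (intro step les uvw H' pq)
    ultimately show ?thesis
      using uvw(4) by linarith
  qed
  have nz: "det3 p q r \<noteq> 0" if "p \<in> g u" "q \<in> g v" "r \<in> g w" for p q r
    using det[OF that] s by auto
  have le4: "\<bar>to_frame p q r y $ i\<bar> \<le> 4" if pqr: "p \<in> g u" "q \<in> g v" "r \<in> g w" and y: "y \<in> H" for p q r y i
  proof -
    have pqrH: "p \<in> H" "q \<in> H" "r \<in> H"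
      using pqr gH uvw by auto
    have *: "\<bar>c / det3 p q r\<bar> \<le> 4" if "\<bar>c\<bar> \<le> s" for c
      using det[OF pqr] that s by (simp add: abs_divide divide_le_eq)
    have "i = 1 \<or> i = 2"
      using exhaust_2 by blast
    then show ?thesis
      using *[OF les, of p y r] *[OF les, of p q y] pqrH y by auto
  qed
  show ?thesis
    by (rule that[OF gH gH gH g_sets g_sets g_sets g_meas g_meas g_meas, OF uvw(1-3)])
       (intro ballI conjI allI nz le4; assumption)
qed

text \<open>In frame coordinates \<open>H\<close> becomes a convex set inside a fixed square that
  contains a fixed ball, so one finite family serves all \<open>H\<close> and all frames. Shrinking
  by \<open>1 - 1/10\<close> keeps \<open>81/100\<close> of the area, and the frame map preserves
  area ratios. A proportion above \<open>3/4\<close> is what the constant 4 of the upper bound calls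
  for.\<close>

lemma finite_frame_shapes:
  obtains \<S> :: "(real^2) set set" where "finite \<S>" "\<forall>S\<in>\<S>. open S"
    "\<forall>H p q r. convex H \<and> p \<in> H \<and> q \<in> H \<and> r \<in> H \<and> det3 p q r \<noteq> 0 \<and>
       (\<forall>y\<in>H. \<forall>i. \<bar>to_frame p q r y $ i\<bar> \<le> 4) \<longrightarrow>
       (\<exists>S\<in>\<S>. from_frame p q r ` S \<subseteq> H \<and> from_frame p q r ` S \<in> sets lebesgue \<and>
         81/100 * measure lebesgue H \<le> measure lebesgue (from_frame p q r ` S))"
proof -
  define B :: "(real^2) set" where "B = {x. \<forall>i. \<bar>x $ i\<bar> \<le> 4}"
  have "B \<subseteq> cbox (\<chi> i. -4) (\<chi> i. 4)"
    by (auto simp: B_def mem_box_cart abs_le_iff minus_le_iff)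
  then have B: "bounded B"
    using bounded_cbox bounded_subset by blast
  have "0 < (1/10::real)" "1/10 < (1::real)" "0 < (1/4::real)"
    by auto
  then obtain \<S> :: "(real^2) set set" where \<S>: "finite \<S>" "\<forall>S\<in>\<S>. open S \<and> bounded S"
    "\<forall>C c. convex C \<and> C \<subseteq> B \<and> ball c (1/4) \<subseteq> C \<longrightarrow>
       (\<exists>S\<in>\<S>. S \<subseteq> C \<and> (1 - 1/10) ^ DIM(real^2) * measure lebesgue C \<le> measure lebesgue S)"
    by (rule finite_inner_approx_family[OF B])
  have shape: "\<exists>S\<in>\<S>. from_frame p q r ` S \<subseteq> H \<and> from_frame p q r ` S \<in> sets lebesgue \<and>
      81/100 * measure lebesgue H \<le> measure lebesgue (from_frame p q r ` S)"
    if H: "convex H" and pqr: "p \<in> H" "q \<in> H" "r \<in> H" and nz: "det3 p q r \<noteq> 0"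
      and le4: "\<forall>y\<in>H. \<forall>i. \<bar>to_frame p q r y $ i\<bar> \<le> 4" for H p q r
  proof -
    let ?C = "to_frame p q r ` H"
    have C: "convex ?C" "?C \<subseteq> B"
      using convex_to_frame_image[OF H] le4 by (auto simp: B_def)
    have CB: "?C \<in> lmeasurable"
      using C B bounded_subset by (blast intro: measurable_convex)
    have "ball (\<chi> i. 1/4) (1/4) \<subseteq> ?C"
      using pqr nz by (intro ball_subset_to_frame_image H) auto
    then obtain S where S: "S \<in> \<S>" "S \<subseteq> ?C" "(1 - 1/10) ^ DIM(real^2) * measure lebesgue ?C \<le> measure lebesgue S"
      using \<S>(3) C by blast
    have Sm: "S \<in> lmeasurable"
      using \<S> S(1) by (intro lmeasurable_open) auto
    have HC: "from_frame p q r ` ?C = H"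
      using from_frame_to_frame[OF nz] by (simp add: image_image)
    have "81/100 * measure lebesgue H = \<bar>det3 p q r\<bar> * (81/100 * measure lebesgue ?C)"
      using from_frame_image(2)[OF CB, of p q r] HC by simp
    also have "\<dots> \<le> \<bar>det3 p q r\<bar> * measure lebesgue S"
      using S(3) by (intro mult_left_mono) (auto simp: power2_eq_square)
    also have "\<dots> = measure lebesgue (from_frame p q r ` S)"
      using from_frame_image(2)[OF Sm] by simp
    finally have "81/100 * measure lebesgue H \<le> measure lebesgue (from_frame p q r ` S)" .
    moreover have "from_frame p q r ` S \<subseteq> H"
      using image_mono[OF S(2), of "from_frame p q r"] by (simp add: HC)
    ultimately show ?thesis
      using from_frame_image(1)[OF Sm] S(1) by blast
  qed
  show ?thesis
    by (rule that[OF \<S>(1)]) (use \<S>(2) shape in blast)+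
qed

section \<open>The upper bound\<close>

text \<open>A first-moment bound that replaces a union bound over a net: the shapes form a continuous
  family \<open>(Q \<theta>)\<close> indexed by a probability space, and one bounds the measure of the set of
  those \<open>\<theta>\<close> whose shape is large but missed by the sample.\<close>

lemma (in prob_space) prob_many_avoided_le:
  fixes N :: "'b measure" and n :: nat and b c :: real
  assumes N: "prob_space N" and Q: "Q \<in> sets (N \<Otimes>\<^sub>M M)" and b: "b \<le> 1" and c: "0 < c"
  defines "P \<equiv> PiM {..<n} (\<lambda>_. M)"
  defines "U \<equiv> \<lambda>\<omega>. {\<theta> \<in> space N. b \<le> measure M (Pair \<theta> -` Q) \<and> (\<forall>i<n. (\<theta>, \<omega> i) \<notin> Q)}"
  shows "\<omega> \<in> space P \<Longrightarrow> U \<omega> \<in> sets N"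
    and "{\<omega> \<in> space P. c \<le> measure N (U \<omega>)} \<in> sets P"
    and "measure P {\<omega> \<in> space P. c \<le> measure N (U \<omega>)} \<le> (1 - b) ^ n / c"
proof -
  interpret N: prob_space N by fact
  interpret P: prob_space P
  proof -
    interpret P: product_prob_space "\<lambda>_. M" "{..<n}" ..
    show "prob_space P"
      unfolding P_def by (rule P.prob_space_axioms)
  qed
  interpret PN: pair_sigma_finite P N ..
  \<comment> \<open>One jointly measurable set whose sections at \<open>\<omega>\<close> are the
    sets \<open>U \<omega>\<close>, so that Tonelli's theorem can exchange sample and
    parameter.\<close>
  define Z where "Z = {x \<in> space (P \<Otimes>\<^sub>M N). b \<le> measure M (Pair (snd x) -` Q) \<and>
    (\<forall>i\<in>{..<n}. (snd x, fst x i) \<notin> Q)}"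
  have Zs: "Z \<in> sets (P \<Otimes>\<^sub>M N)"
    unfolding Z_def
  proof (intro sets.sets_Collect_conj sets.sets_Collect_finite_All)
    have "(\<lambda>\<theta>. measure M (Pair \<theta> -` Q)) \<in> borel_measurable N"
      unfolding measure_def using measurable_emeasure_Pair[OF Q] by measurable
    from measurable_compose[OF measurable_snd this]
    show "{x \<in> space (P \<Otimes>\<^sub>M N). b \<le> measure M (Pair (snd x) -` Q)} \<in> sets (P \<Otimes>\<^sub>M N)"
      by measurable
  next
    fix i assume "i \<in> {..<n}"
    then have "(\<lambda>\<omega>. \<omega> i) \<in> P \<rightarrow>\<^sub>M M"
      unfolding P_def by (rule measurable_component_singleton)
    then have "(\<lambda>x. (snd x, fst x i)) \<in> P \<Otimes>\<^sub>M N \<rightarrow>\<^sub>M N \<Otimes>\<^sub>M M"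
      by (intro measurable_Pair measurable_snd measurable_compose[OF measurable_fst])
    from measurable_sets[OF this sets.compl_sets[OF Q]]
    have "(\<lambda>x. (snd x, fst x i)) -` (space (N \<Otimes>\<^sub>M M) - Q) \<inter> space (P \<Otimes>\<^sub>M N) \<in> sets (P \<Otimes>\<^sub>M N)" .
    moreover have "(\<lambda>x. (snd x, fst x i)) -` (space (N \<Otimes>\<^sub>M M) - Q) \<inter> space (P \<Otimes>\<^sub>M N) =
        {x \<in> space (P \<Otimes>\<^sub>M N). (snd x, fst x i) \<notin> Q}"
      using measurable_space[OF \<open>(\<lambda>x. (snd x, fst x i)) \<in> P \<Otimes>\<^sub>M N \<rightarrow>\<^sub>M N \<Otimes>\<^sub>M M\<close>] by blast
    ultimately show "{x \<in> space (P \<Otimes>\<^sub>M N). (snd x, fst x i) \<notin> Q} \<in> sets (P \<Otimes>\<^sub>M N)"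
      by simp
  qed auto
  have sec: "Pair \<omega> -` Z = U \<omega>" if "\<omega> \<in> space P" for \<omega>
    using that by (auto simp: Z_def U_def space_pair_measure)
  show Us: "U \<omega> \<in> sets N" if "\<omega> \<in> space P" for \<omega>
    using sets_Pair1[OF Zs, of \<omega>] sec[OF that] by simp
  have meas: "(\<lambda>\<omega>. measure N (U \<omega>)) \<in> borel_measurable P"
  proof (subst measurable_cong)
    show "(\<lambda>\<omega>. measure N (Pair \<omega> -` Z)) \<in> borel_measurable P"
      unfolding measure_def using N.measurable_emeasure_Pair[OF Zs] by measurable
  qed (simp add: sec)
  show "{\<omega> \<in> space P. c \<le> measure N (U \<omega>)} \<in> sets P"
    using meas by measurable
  have int: "integrable P (\<lambda>\<omega>. measure N (U \<omega>))"
    by (rule P.integrable_const_bound[of _ 1]) (use meas in auto)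
  have b0: "0 \<le> (1 - b) ^ n"
    using b by simp
  \<comment> \<open>The expected measure of \<open>U \<omega>\<close> is the average over
    \<open>\<theta>\<close> of the probability that a single large shape is missed, which is at most
    \<open>(1 - b) ^ n\<close>.\<close>
  have "ennreal (\<integral>\<omega>. measure N (U \<omega>) \<partial>P) = (\<integral>\<^sup>+\<omega>. ennreal (measure N (U \<omega>)) \<partial>P)"
    by (rule nn_integral_eq_integral[symmetric, OF int]) simp
  also have "\<dots> = (\<integral>\<^sup>+\<omega>. emeasure N (Pair \<omega> -` Z) \<partial>P)"
    by (rule nn_integral_cong) (simp add: sec N.emeasure_eq_measure)
  also have "\<dots> = emeasure (P \<Otimes>\<^sub>M N) Z"
    by (rule N.emeasure_pair_measure_alt[OF Zs, symmetric])
  also have "\<dots> = (\<integral>\<^sup>+\<theta>. emeasure P ((\<lambda>\<omega>. (\<omega>, \<theta>)) -` Z) \<partial>N)"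
    by (rule PN.emeasure_pair_measure_alt2[OF Zs])
  also have "\<dots> \<le> (\<integral>\<^sup>+\<theta>. ennreal ((1 - b) ^ n) \<partial>N)"
  proof (rule nn_integral_mono)
    fix \<theta> assume \<theta>: "\<theta> \<in> space N"
    show "emeasure P ((\<lambda>\<omega>. (\<omega>, \<theta>)) -` Z) \<le> ennreal ((1 - b) ^ n)"
    proof (cases "b \<le> measure M (Pair \<theta> -` Q)")
      case True
      then have "(\<lambda>\<omega>. (\<omega>, \<theta>)) -` Z = {\<omega> \<in> space P. \<forall>i<n. \<omega> i \<notin> Pair \<theta> -` Q}"
        using \<theta> by (auto simp: Z_def space_pair_measure)
      moreover have "measure P {\<omega> \<in> space P. \<forall>i<n. \<omega> i \<notin> Pair \<theta> -` Q} = (1 - measure M (Pair \<theta> -` Q)) ^ n"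
        unfolding P_def by (rule prob_avoid[OF sets_Pair1[OF Q]])
      moreover have "(1 - measure M (Pair \<theta> -` Q)) ^ n \<le> (1 - b) ^ n"
        using True by (intro power_mono) auto
      ultimately show ?thesis
        by (simp only: P.emeasure_eq_measure ennreal_leI)
    next
      case False
      then have "(\<lambda>\<omega>. (\<omega>, \<theta>)) -` Z = {}"
        by (auto simp: Z_def)
      then show ?thesis
        by (simp only: emeasure_empty zero_le)
    qed
  qed
  also have "\<dots> = ennreal ((1 - b) ^ n)"
    by (simp add: N.emeasure_space_1)
  finally have le: "(\<integral>\<omega>. measure N (U \<omega>) \<partial>P) \<le> (1 - b) ^ n"
    using b0 by (simp only: ennreal_le_iff)
  have "measure P {\<omega> \<in> space P. c \<le> measure N (U \<omega>)} \<le> (\<integral>\<omega>. measure N (U \<omega>) \<partial>P) / c"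
    by (rule integral_Markov_inequality_measure[OF int sets.empty_sets _ c]) simp
  also have "\<dots> \<le> (1 - b) ^ n / c"
    using le c by (intro divide_right_mono) auto
  finally show "measure P {\<omega> \<in> space P. c \<le> measure N (U \<omega>)} \<le> (1 - b) ^ n / c" .
qed

section \<open>Triples of points of the body as random frames\<close>

lemma measurable_det3:
  fixes p q r :: "'a \<Rightarrow> real^2"
  assumes "p \<in> borel_measurable N" "q \<in> borel_measurable N" "r \<in> borel_measurable N"
  shows "(\<lambda>x. det3 (p x) (q x) (r x)) \<in> borel_measurable N"
proof -
  have nth: "(\<lambda>x. f x $ i) \<in> borel_measurable N" if "f \<in> borel_measurable N" for f :: "'a \<Rightarrow> real^2" and i
    by (rule measurable_compose[OF that])
       (intro borel_measurable_continuous_onI continuous_intros)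
  show ?thesis
    unfolding det3_def
    by (intro borel_measurable_diff borel_measurable_times nth assms)
qed

context unit_area_body
begin

definition shape_relation :: "(real^2) set \<Rightarrow> (((real^2) \<times> (real^2) \<times> (real^2)) \<times> (real^2)) set" where
  "shape_relation S = {((p, q, r), y). det3 p q r \<noteq> 0 \<and> to_frame p q r y \<in> S}"

lemma shape_relation_sets:
  assumes "open S"
  shows "shape_relation S \<in> sets ((M \<Otimes>\<^sub>M (M \<Otimes>\<^sub>M M)) \<Otimes>\<^sub>M M)"
proof -
  let ?N = "(M \<Otimes>\<^sub>M (M \<Otimes>\<^sub>M M)) \<Otimes>\<^sub>M M"
  have id: "(\<lambda>x. x) \<in> borel_measurable M"
    by (rule measurable_M_borel) simp
  have p: "(\<lambda>x. fst (fst x)) \<in> borel_measurable ?N"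
    by (intro measurable_compose[OF _ id] measurable_compose[OF measurable_fst] measurable_fst)
  have q: "(\<lambda>x. fst (snd (fst x))) \<in> borel_measurable ?N"
    by (intro measurable_compose[OF _ id] measurable_compose[OF measurable_fst]
        measurable_compose[OF measurable_snd] measurable_fst)
  have r: "(\<lambda>x. snd (snd (fst x))) \<in> borel_measurable ?N"
    by (intro measurable_compose[OF _ id] measurable_compose[OF measurable_fst]
        measurable_compose[OF measurable_snd] measurable_snd)
  have y: "snd \<in> borel_measurable ?N"
    by (rule measurable_compose[OF measurable_snd id, simplified])
  note d = measurable_det3[OF p q r] measurable_det3[OF p y r] measurable_det3[OF p q y]
  have t: "(\<lambda>x. to_frame (fst (fst x)) (fst (snd (fst x))) (snd (snd (fst x))) (snd x)) \<in> borel_measurable ?N"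
    unfolding to_frame_def
    by (intro borel_measurable_add borel_measurable_scaleR borel_measurable_divide d borel_measurable_const)
  have "shape_relation S =
      ((\<lambda>x. det3 (fst (fst x)) (fst (snd (fst x))) (snd (snd (fst x)))) -` (- {0}) \<inter> space ?N) \<inter>
      ((\<lambda>x. to_frame (fst (fst x)) (fst (snd (fst x))) (snd (snd (fst x))) (snd x)) -` S \<inter> space ?N)"
    by (auto simp: shape_relation_def space_pair_measure)
  also have "\<dots> \<in> sets ?N"
    using assms by (intro sets.Int measurable_sets[OF d(1)] measurable_sets[OF t]) auto
  finally show ?thesis .
qed

lemma shape_relation_section:
  assumes nz: "det3 p q r \<noteq> 0"
  shows "Pair (p, q, r) -` shape_relation S = from_frame p q r ` S"
proof (intro set_eqI iffI)
  fix y assume "y \<in> Pair (p, q, r) -` shape_relation S"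
  then have "to_frame p q r y \<in> S"
    by (simp add: shape_relation_def)
  then show "y \<in> from_frame p q r ` S"
    using from_frame_to_frame[OF nz, of y] by (metis imageI)
next
  fix y assume "y \<in> from_frame p q r ` S"
  then obtain x where x: "y = from_frame p q r x" "x \<in> S"
    by blast
  show "y \<in> Pair (p, q, r) -` shape_relation S"
    using x(2) nz to_frame_from_frame[OF nz, of x] by (simp add: shape_relation_def x(1))
qed

lemma measure_M_triple:
  assumes "X \<in> sets lebesgue" "Y \<in> sets lebesgue" "Z \<in> sets lebesgue"
  shows "measure (M \<Otimes>\<^sub>M (M \<Otimes>\<^sub>M M)) (X \<times> Y \<times> Z) = measure M X * (measure M Y * measure M Z)"
proof -
  interpret MM: pair_prob_space M M ..
  have "emeasure (M \<Otimes>\<^sub>M (M \<Otimes>\<^sub>M M)) (X \<times> Y \<times> Z) = emeasure M X * (emeasure M Y * emeasure M Z)"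
    using assms by (subst MM.P.emeasure_pair_measure_Times; (subst M.emeasure_pair_measure_Times)?) auto
  then show ?thesis
    by (simp add: measure_def enn2real_mult)
qed

text \<open>For a hole of area above \<open>A\<close>, the good triples have measure at least
  \<open>((1/24)\<^sup>2 * A) ^ 3\<close>, and each of them carries a large shape missed by the
  sample. By pigeonhole one shape accounts for at least the share \<open>c\<close>; a union bound
  over the shapes concludes.\<close>

lemma prob_less_max_hole_le:
  obtains C where "\<forall>A n. 0 < A \<and> A \<le> 1 \<longrightarrow>
    P.prob n {\<omega> \<in> space (uniform_points K n). A < max_hole K (\<omega> ` {..<n})} \<le> C * ((1 - 81/100 * A) ^ n / A ^ 3)"
proof -
  obtain \<S> :: "(real^2) set set" where \<S>: "finite \<S>" "\<forall>S\<in>\<S>. open S"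
    and shape: "\<forall>H p q r. convex H \<and> p \<in> H \<and> q \<in> H \<and> r \<in> H \<and> det3 p q r \<noteq> 0 \<and>
       (\<forall>y\<in>H. \<forall>i. \<bar>to_frame p q r y $ i\<bar> \<le> 4) \<longrightarrow>
       (\<exists>S\<in>\<S>. from_frame p q r ` S \<subseteq> H \<and> from_frame p q r ` S \<in> sets lebesgue \<and>
         81/100 * measure lebesgue H \<le> measure lebesgue (from_frame p q r ` S))"
    by (rule finite_frame_shapes)
  \<comment> \<open>The added 1 makes the pigeonhole inequality strict and the division by
    \<open>m\<close> safe.\<close>
  define m where "m = real (card \<S>) + 1"
  have m: "m > 0"
    by (simp add: m_def)
  define N where "N = M \<Otimes>\<^sub>M (M \<Otimes>\<^sub>M M)"
  have N: "prob_space N"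
  proof -
    interpret MM: pair_prob_space M M ..
    interpret MMM: pair_prob_space M "M \<Otimes>\<^sub>M M" ..
    show ?thesis
      unfolding N_def by (rule MMM.prob_space_axioms)
  qed
  interpret N: prob_space N by fact
  have spN: "space N = UNIV"
    by (simp add: N_def space_pair_measure)
  have bound: "P.prob n {\<omega> \<in> space (uniform_points K n). A < max_hole K (\<omega> ` {..<n})}
      \<le> (m * m * 24 ^ 6) * ((1 - 81/100 * A) ^ n / A ^ 3)" if A: "0 < A" "A \<le> 1" for A n
  proof -
    define b where "b = 81/100 * A"
    define c where "c = ((1/24)\<^sup>2 * A) ^ 3 / m"
    have b: "b \<le> 1" and c: "c > 0"
      using A m by (simp_all add: b_def c_def)
    define U where "U S \<omega> = {\<theta> \<in> space N. b \<le> measure M (Pair \<theta> -` shape_relation S) \<and>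
      (\<forall>i<n. (\<theta>, \<omega> i) \<notin> shape_relation S)}" for S and \<omega> :: "nat \<Rightarrow> real^2"
    define E where "E S = {\<omega> \<in> space (uniform_points K n). c \<le> measure N (U S \<omega>)}" for S
    note ineq = M.prob_many_avoided_le[OF N shape_relation_sets[folded N_def] b c, where n = n,
        folded uniform_points_def, folded U_def]
    have E: "E S \<in> P.events n" "P.prob n (E S) \<le> (1 - b) ^ n / c" if "S \<in> \<S>" for S
      unfolding E_def using ineq(2,3)[of S] \<S>(2) that by auto
    have "{\<omega> \<in> space (uniform_points K n). A < max_hole K (\<omega> ` {..<n})} \<subseteq> (\<Union>S\<in>\<S>. E S)"
    proof
      fix \<omega> assume "\<omega> \<in> {\<omega> \<in> space (uniform_points K n). A < max_hole K (\<omega> ` {..<n})}"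
      then have \<omega>: "\<omega> \<in> space (uniform_points K n)" "A < max_hole K (\<omega> ` {..<n})"
        by auto
      obtain H0 where H0: "convex H0" "H0 \<subseteq> K" "interior H0 \<inter> \<omega> ` {..<n} = {}" "A < measure lebesgue H0"
        using \<omega>(2) unfolding less_max_hole_iff[OF K_lmeasurable] hole_def by blast
      \<comment> \<open>A hole may contain sample points on its frontier; its interior contains none
        and has the same area.\<close>
      define H where "H = interior H0"
      have H: "convex H" "H \<subseteq> K" "H \<inter> \<omega> ` {..<n} = {}" "A < measure lebesgue H"
        using H0 interior_subset[of H0] convex_interior[OF H0(1)] measure_interior_convex[OF H0(1)]
        by (auto simp: H_def)
      have Hl: "H \<in> lmeasurable"
        by (rule lmeasurable_subset_convex[OF K_lmeasurable H(1,2)])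
      have Hpos: "measure lebesgue H > 0"
        using A H by linarith
      obtain X Y Z where sub: "X \<subseteq> H" "Y \<subseteq> H" "Z \<subseteq> H"
        and sets: "X \<in> sets lebesgue" "Y \<in> sets lebesgue" "Z \<in> sets lebesgue"
        and area: "measure lebesgue X = (1/24)\<^sup>2 * measure lebesgue H"
          "measure lebesgue Y = (1/24)\<^sup>2 * measure lebesgue H"
          "measure lebesgue Z = (1/24)\<^sup>2 * measure lebesgue H"
        and good: "\<forall>p\<in>X. \<forall>q\<in>Y. \<forall>r\<in>Z. det3 p q r \<noteq> 0 \<and> (\<forall>y\<in>H. \<forall>i. \<bar>to_frame p q r y $ i\<bar> \<le> 4)"
        by (rule ex_many_good_frames[OF H(1) Hl Hpos])
      have "\<exists>S\<in>\<S>. (p, q, r) \<in> U S \<omega>" if pqr: "p \<in> X" "q \<in> Y" "r \<in> Z" for p q r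
      proof -
        have nz: "det3 p q r \<noteq> 0"
          using good pqr by blast
        have "convex H \<and> p \<in> H \<and> q \<in> H \<and> r \<in> H \<and> det3 p q r \<noteq> 0 \<and>
            (\<forall>y\<in>H. \<forall>i. \<bar>to_frame p q r y $ i\<bar> \<le> 4)"
          using good pqr sub H(1) by blast
        then obtain S where S: "S \<in> \<S>" "from_frame p q r ` S \<subseteq> H" "from_frame p q r ` S \<in> sets lebesgue"
            "81/100 * measure lebesgue H \<le> measure lebesgue (from_frame p q r ` S)"
          using shape by meson
        have "b \<le> measure M (Pair (p, q, r) -` shape_relation S)"
          unfolding shape_relation_section[OF nz] using S H b_def
          by (subst measure_M_subset) auto
        moreover have "(((p, q, r), \<omega> i) \<notin> shape_relation S)" if "i < n" for i
        proof
          assume "((p, q, r), \<omega> i) \<in> shape_relation S"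
          then have "\<omega> i \<in> Pair (p, q, r) -` shape_relation S"
            by simp
          then have "\<omega> i \<in> H"
            unfolding shape_relation_section[OF nz] using S(2) by blast
          then show False
            using H(3) that by blast
        qed
        ultimately have "(p, q, r) \<in> U S \<omega>"
          unfolding U_def spN by blast
        then show ?thesis
          using S(1) by blast
      qed
      then have cover: "X \<times> Y \<times> Z \<subseteq> (\<Union>S\<in>\<S>. U S \<omega>)"
        by blast
      have Us: "(\<lambda>S. U S \<omega>) ` \<S> \<subseteq> N.events"
        using ineq(1)[OF _ \<omega>(1)] \<S>(2) by blast
      have "((1/24)\<^sup>2 * A) ^ 3 \<le> ((1/24)\<^sup>2 * measure lebesgue H) ^ 3"
        using A H(4) by (intro power_mono mult_left_mono) auto
      also have "\<dots> = measure N (X \<times> Y \<times> Z)"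
        unfolding N_def measure_M_triple[OF sets] using sub H(2) sets
        by (simp add: measure_M_subset area power3_eq_cube)
      also have "\<dots> \<le> measure N (\<Union>S\<in>\<S>. U S \<omega>)"
        using Us \<S>(1) by (intro N.finite_measure_mono cover sets.finite_UN) auto
      also have "\<dots> \<le> (\<Sum>S\<in>\<S>. measure N (U S \<omega>))"
        by (rule N.finite_measure_subadditive_finite[OF \<S>(1) Us])
      finally have large: "((1/24)\<^sup>2 * A) ^ 3 \<le> (\<Sum>S\<in>\<S>. measure N (U S \<omega>))" .
      show "\<omega> \<in> (\<Union>S\<in>\<S>. E S)"
      proof (rule ccontr)
        assume "\<omega> \<notin> (\<Union>S\<in>\<S>. E S)"
        then have "measure N (U S \<omega>) \<le> c" if "S \<in> \<S>" for S
          using that \<omega>(1) by (force simp: E_def)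
        then have "(\<Sum>S\<in>\<S>. measure N (U S \<omega>)) \<le> real (card \<S>) * c"
          by (rule sum_bounded_above)
        also have "\<dots> < m * c"
          using c by (simp add: m_def)
        also have "\<dots> = ((1/24)\<^sup>2 * A) ^ 3"
          using m by (simp add: c_def)
        finally show False
          using large by simp
      qed
    qed
    then have "P.prob n {\<omega> \<in> space (uniform_points K n). A < max_hole K (\<omega> ` {..<n})} \<le> P.prob n (\<Union>S\<in>\<S>. E S)"
      using E(1) \<S>(1) by (intro P.finite_measure_mono sets.finite_UN)
    also have "\<dots> \<le> (\<Sum>S\<in>\<S>. P.prob n (E S))"
      using E(1) \<S>(1) by (intro P.finite_measure_subadditive_finite) auto
    also have "\<dots> \<le> real (card \<S>) * ((1 - b) ^ n / c)"
      by (rule sum_bounded_above) (rule E(2))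
    also have "\<dots> \<le> m * ((1 - b) ^ n / c)"
      using b c by (intro mult_right_mono divide_nonneg_pos) (auto simp: m_def)
    also have "\<dots> = (m * m * 24 ^ 6) * ((1 - 81/100 * A) ^ n / A ^ 3)"
      using A m by (simp add: b_def c_def field_simps)
    finally show ?thesis .
  qed
  show ?thesis
    by (rule that) (use bound in blast)
qed

text \<open>Larger \<open>c\<close> only shrinks the event, so it is enough to bound the case of the
  constant 4.\<close>

lemma max_hole_upper_bound:
  assumes c: "4 \<le> c"
  shows "(\<lambda>n. P.prob n {\<omega> \<in> space (uniform_points K n).
            c * (ln (real n) / real n) < max_hole K (\<omega> ` {..<n})}) \<longlonglongrightarrow> 0"
proof -
  obtain C where C: "\<forall>A n. 0 < A \<and> A \<le> 1 \<longrightarrow>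
    P.prob n {\<omega> \<in> space (uniform_points K n). A < max_hole K (\<omega> ` {..<n})} \<le> C * ((1 - 81/100 * A) ^ n / A ^ 3)"
    by (rule prob_less_max_hole_le)
  define a where "a n = 4 * (ln (real n) / real n)" for n :: nat
  \<comment> \<open>the numerator is of order \<open>n powr (-3.24)\<close>, which beats the cube in the denominator\<close>
  have "(\<lambda>n. (1 - 81/100 * a n) ^ n / a n ^ 3) \<longlonglongrightarrow> 0"
    unfolding a_def by real_asymp
  then have lim: "(\<lambda>n. C * ((1 - 81/100 * a n) ^ n / a n ^ 3)) \<longlonglongrightarrow> 0"
    by (rule tendsto_mult_right_zero)
  have "eventually (\<lambda>n. 0 < a n) sequentially"
    unfolding a_def by real_asymp
  moreover have "eventually (\<lambda>n. a n \<le> 1) sequentially"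
    unfolding a_def by real_asymp
  ultimately have ev: "eventually (\<lambda>n. P.prob n {\<omega> \<in> space (uniform_points K n).
       c * (ln (real n) / real n) < max_hole K (\<omega> ` {..<n})} \<le> C * ((1 - 81/100 * a n) ^ n / a n ^ 3)) sequentially"
  proof eventually_elim
    case (elim n)
    have "0 \<le> ln (real n) / real n"
      using elim by (simp add: a_def)
    then have "a n \<le> c * (ln (real n) / real n)"
      unfolding a_def using c by (intro mult_right_mono)
    then have "P.prob n {\<omega> \<in> space (uniform_points K n). c * (ln (real n) / real n) < max_hole K (\<omega> ` {..<n})}
      \<le> P.prob n {\<omega> \<in> space (uniform_points K n). a n < max_hole K (\<omega> ` {..<n})}"
      by (intro P.finite_measure_mono) auto
    also have "\<dots> \<le> C * ((1 - 81/100 * a n) ^ n / a n ^ 3)"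
      using C elim by blast
    finally show ?case .
  qed
  show ?thesis
    by (rule tendsto_sandwich[OF _ ev tendsto_const lim]) simp
qed

end

section \<open>Combination of the two tail bounds\<close>

theorem theorem1p2:
  fixes K :: "(real^2) set"
  assumes "convex K" and "emeasure lebesgue K = 1"
  shows "\<forall>\<epsilon>>0. (\<lambda>n. \<P>(\<omega> in uniform_points K n.
            (1 - \<epsilon>) * (ln (real n) / real n) \<le> max_hole K (\<omega> ` {..<n}) \<and>
            max_hole K (\<omega> ` {..<n}) \<le> (4 + \<epsilon>) * (ln (real n) / real n)))
          \<longlonglongrightarrow> 1"
proof (intro allI impI)
  fix \<epsilon> :: real assume \<epsilon>: "\<epsilon> > 0"
  interpret unit_area_body K
    using assms by unfold_locales
  define lo where "lo n = {\<omega> \<in> space (uniform_points K n).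
    max_hole K (\<omega> ` {..<n}) < (1 - \<epsilon>) * (ln (real n) / real n)}" for n
  define hi where "hi n = {\<omega> \<in> space (uniform_points K n).
    (4 + \<epsilon>) * (ln (real n) / real n) < max_hole K (\<omega> ` {..<n})}" for n
  have events: "lo n \<in> P.events n" "hi n \<in> P.events n" for n
    unfolding lo_def hi_def by measurable
  have "(\<lambda>n. 1 - (P.prob n (lo n) + P.prob n (hi n))) \<longlonglongrightarrow> 1 - (0 + 0)"
    unfolding lo_def hi_def using \<epsilon>
    by (intro tendsto_intros max_hole_lower_bound max_hole_upper_bound) auto
  then have lim: "(\<lambda>n. 1 - (P.prob n (lo n) + P.prob n (hi n))) \<longlonglongrightarrow> 1"
    by simp
  have eq: "{\<omega> \<in> space (uniform_points K n). (1 - \<epsilon>) * (ln (real n) / real n) \<le> max_hole K (\<omega> ` {..<n}) \<and>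
      max_hole K (\<omega> ` {..<n}) \<le> (4 + \<epsilon>) * (ln (real n) / real n)} =
      space (uniform_points K n) - (lo n \<union> hi n)" for n
    by (auto simp: lo_def hi_def)
  \<comment> \<open>Union bound for the two bad events; the upper side of the sandwich is the
    trivial bound 1.\<close>
  have ge: "1 - (P.prob n (lo n) + P.prob n (hi n)) \<le> P.prob n (space (uniform_points K n) - (lo n \<union> hi n))" for n
    using events[of n] measure_Un_le[OF events, of n] P.prob_compl[of "lo n \<union> hi n" n] by simp
  show "(\<lambda>n. \<P>(\<omega> in uniform_points K n. (1 - \<epsilon>) * (ln (real n) / real n) \<le> max_hole K (\<omega> ` {..<n}) \<and>
      max_hole K (\<omega> ` {..<n}) \<le> (4 + \<epsilon>) * (ln (real n) / real n))) \<longlonglongrightarrow> 1"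
    unfolding eq
    by (rule tendsto_sandwich[OF _ _ lim tendsto_const]) (simp_all add: ge)
qed

end
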